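(* Assume (A1) and (A2) as stated in the context. Let $\mu_y^h,\mu_y^r,\mu_y^\Delta$ be the posterior distributions on $\Theta$ with densities $$p_y^\bullet(\theta)=\frac1{Z_\bullet}\exp(-\eta_y^\bullet(\theta))\,p_0(\theta),\qquad Z_\bullet=\int_\Theta\exp(-\eta_y^\bullet(\theta))\,p_0(\theta)\,d\theta,\qquad \bullet\in\{h,r,\Delta\},$$ where $\eta_y^h(\theta)=\eta_y(u_h(\theta))$, $\eta_y^r(\theta)=\eta_y(u_r(\theta))$ and $\eta_y^\Delta(\theta)=\eta_y(u_r(\theta))+A(u_r(\theta),\psi_r(\theta);\theta)-F(\psi_r(\theta);\theta)$. Put $e_r^\eta=\eta_y^h-\eta_y^r$ and $e_r^\Delta=\eta_y^h-\eta_y^\Delta$. Then $$D_{\mathrm{KL}}(\mu_y^h\,|\,\mu_y^r)\le\mathbb E_{\mu_y^h}\big[|e_r^\eta|\big]+\mathbb E_{\mu_y^h}\big[|\exp(e_r^\eta)-1|\big]$$ and $$D_{\mathrm{KL}}(\mu_y^h\,|\,\mu_y^\Delta)\le\mathbb E_{\mu_y^h}\big[|e_r^\Delta|\big]+\mathbb E_{\mu_y^h}\big[|\exp(e_r^\Delta)-1|\big].$$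
   Context: Setting. $V$ is a real Hilbert space with dual $V'$; $\Theta\subset\mathbb R^d$ is the (measurable) parameter set and $p_0:\Theta\to\mathbb R$ is a probability density (the prior) with respect to Lebesgue measure; for each $\theta\in\Theta$, $A(\cdot,\cdot;\theta):V\times V\to\mathbb R$ is bilinear and $F(\cdot;\theta):V\to\mathbb R$ is linear. $\mathcal O=(o_1,\dots,o_s)$ with $o_i\in V'$; $y\in\mathbb R^s$; $\Gamma\in\mathbb R^{s\times s}$ is symmetric positive definite. The potential is $\eta_y(u)=\frac12(y-\mathcal O(u))^T\Gamma^{-1}(y-\mathcal O(u))$ for $u\in V$, with derivative $\nabla_u\eta_y|_u(w)=-(y-\mathcal O(u))^T\Gamma^{-1}\mathcal O(w)$. Assumptions. (A1) For every $\theta\in\Theta$ there are $\alpha(\theta)>0$, $\gamma(\theta)>0$ with $\alpha(\theta)\|w\|_V^2\le A(w,w;\theta)$ and $A(w,v;\theta)\le\gamma(\theta)\|w\|_V\|v\|_V$ for all $w,v\in V$, and $\|F(\cdot;\theta)\|_{V'}<\infty$. (A2) $A(\cdot,\cdot;\theta)$ and $F(\cdot;\theta)$ are continuously differentiable in $\theta$ at every $\theta\in\Theta$ (in particular continuous in $\theta$), and for each $j=1,\dots,d$ there is $0<\rho_j(\theta)<\infty$ with $\partial_{\theta_j}A(w,v;\theta)\le\rho_j(\theta)\|w\|_V\|v\|_V$ for all $w,v\in V$, and $\|\partial_{\theta_j}F(\cdot;\theta)\|_{V'}<\infty$. Discrete problems. $V_h\subset V$ is a finite-dimensional subspace; $V_r,W_r\subset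 V_h$ are subspaces (all independent of $\theta$). For each $\theta$: $u_h\in V_h$ solves $A(u_h,v;\theta)=F(v;\theta)$ for all $v\in V_h$; $u_r\in V_r$ solves $A(u_r,v;\theta)=F(v;\theta)$ for all $v\in V_r$; $\psi_r\in W_r$ solves $A(w,\psi_r;\theta)=-\nabla_u\eta_y|_{u_r}(w)$ for all $w\in W_r$. Conventions. The normalization constants are assumed finite so that the three posteriors are well defined (this is automatic for $Z_h,Z_r$). For probability measures $\mu_1\ll\mu_2$ with densities $p_1,p_2$, $D_{\mathrm{KL}}(\mu_1|\mu_2):=\int_\Theta p_1(\theta)\log\frac{p_1(\theta)}{p_2(\theta)}\,d\theta$. Expectations on the right-hand sides may be $+\infty$. *)

theory Defs
  imports "HOL-Probability.Probability"
begin

text \<open>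
  A parametrised form \<open>A(w, v; \<theta>)\<close> is written \<open>A w v \<theta>\<close>; values at parameters outside \<open>\<Theta>\<close>
  are irrelevant.  The dual norm of a functional is finite iff it is \<^const>\<open>bounded_linear\<close>.
\<close>

definition assumption_A1 ::
  "(real^'d) set \<Rightarrow> ('v::real_inner \<Rightarrow> 'v \<Rightarrow> real^'d \<Rightarrow> real) \<Rightarrow> ('v \<Rightarrow> real^'d \<Rightarrow> real) \<Rightarrow> bool" where
  "assumption_A1 \<Theta> A F \<longleftrightarrow>
     (\<forall>\<theta>\<in>\<Theta>.
        (\<exists>\<alpha>>0. \<forall>w. \<alpha> * (norm w)\<^sup>2 \<le> A w w \<theta>) \<and>
        (\<exists>\<gamma>>0. \<forall>w v. A w v \<theta> \<le> \<gamma> * norm w * norm v) \<and>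
        bounded_linear (\<lambda>v. F v \<theta>))"

text \<open>
  \<open>g\<close> is continuously differentiable in \<open>\<theta>\<close> at every point of \<open>\<Theta>\<close>, with partial derivatives
  \<open>\<partial>g/\<partial>\<theta>\<^sub>j = g' j\<close>.  As \<open>\<Theta>\<close> need not be open, derivatives are taken within \<open>\<Theta>\<close>; this is implied by
  (and, for open \<open>\<Theta>\<close>, the same as) continuous differentiability on a neighbourhood of \<open>\<Theta>\<close>.
\<close>

definition C1_with_partials ::
  "(real^'d) set \<Rightarrow> (real^'d \<Rightarrow> real) \<Rightarrow> ('d \<Rightarrow> real^'d \<Rightarrow> real) \<Rightarrow> bool" where
  "C1_with_partials \<Theta> g g' \<longleftrightarrow>
     (\<forall>\<theta>\<in>\<Theta>. (g has_derivative (\<lambda>h. \<Sum>j\<in>UNIV. g' j \<theta> * h $ j)) (at \<theta> within \<Theta>)) \<and>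
     (\<forall>j. continuous_on \<Theta> (g' j))"

definition assumption_A2 ::
  "(real^'d) set \<Rightarrow> ('v::real_inner \<Rightarrow> 'v \<Rightarrow> real^'d \<Rightarrow> real) \<Rightarrow> ('v \<Rightarrow> real^'d \<Rightarrow> real) \<Rightarrow> bool" where
  "assumption_A2 \<Theta> A F \<longleftrightarrow>
     (\<exists>(dA :: 'd \<Rightarrow> 'v \<Rightarrow> 'v \<Rightarrow> real^'d \<Rightarrow> real) (dF :: 'd \<Rightarrow> 'v \<Rightarrow> real^'d \<Rightarrow> real).
        (\<forall>w v. C1_with_partials \<Theta> (A w v) (\<lambda>j. dA j w v)) \<and>
        (\<forall>v. C1_with_partials \<Theta> (F v) (\<lambda>j. dF j v)) \<and>
        (\<forall>\<theta>\<in>\<Theta>. \<forall>j.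
           (\<exists>\<rho>>0. \<forall>w v. dA j w v \<theta> \<le> \<rho> * norm w * norm v) \<and>
           bounded_linear (\<lambda>v. dF j v \<theta>)))"

definition symmetric_posdef :: "real^'n^'n \<Rightarrow> bool" where
  "symmetric_posdef \<Gamma> \<longleftrightarrow> transpose \<Gamma> = \<Gamma> \<and> (\<forall>x. x \<noteq> 0 \<longrightarrow> 0 < x \<bullet> (\<Gamma> *v x))"

definition observe :: "('s \<Rightarrow> 'v \<Rightarrow> real) \<Rightarrow> 'v \<Rightarrow> real^'s" where
  "observe obs u = (\<chi> i. obs i u)"

definition potential :: "('s \<Rightarrow> 'v \<Rightarrow> real) \<Rightarrow> real^'s \<Rightarrow> real^'s^'s \<Rightarrow> 'v \<Rightarrow> real" where
  "potential obs y \<Gamma> u = (1/2) * ((y - observe obs u) \<bullet> (matrix_inv \<Gamma> *v (y - observe obs u)))"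

definition potential_deriv ::
  "('s \<Rightarrow> 'v \<Rightarrow> real) \<Rightarrow> real^'s \<Rightarrow> real^'s^'s \<Rightarrow> 'v \<Rightarrow> 'v \<Rightarrow> real" where
  "potential_deriv obs y \<Gamma> u w = - ((y - observe obs u) \<bullet> (matrix_inv \<Gamma> *v observe obs w))"

lemma symmetric_posdef_invertible:
  assumes "symmetric_posdef (\<Gamma> :: real^'n^'n)"
  shows "invertible \<Gamma>"
proof -
  have "x = 0" if "\<Gamma> *v x = 0" for x
    using assms that unfolding symmetric_posdef_def by (metis inner_zero_right less_irrefl)
  then show ?thesis
    using invertible_left_inverse matrix_left_invertible_ker by blast
qed

lemma transpose_matrix_inv_symmetric_posdef:
  assumes "symmetric_posdef (\<Gamma> :: real^'n^'n)"
  shows "transpose (matrix_inv \<Gamma>) = matrix_inv \<Gamma>"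
proof -
  note inv = symmetric_posdef_invertible[OF assms]
  have sym: "transpose \<Gamma> = \<Gamma>" using assms by (simp add: symmetric_posdef_def)
  have right: "\<Gamma> ** matrix_inv \<Gamma> = mat 1"
    using inv unfolding invertible_def matrix_inv_def by (rule someI2_ex) simp
  have "transpose (matrix_inv \<Gamma>) ** \<Gamma> = mat 1"
    by (metis right matrix_transpose_mul sym transpose_mat)
  then show ?thesis
    by (metis right matrix_mul_assoc matrix_mul_lid matrix_mul_rid)
qed

lemma potential_has_derivative:
  fixes obs :: "'s::finite \<Rightarrow> 'v::real_normed_vector \<Rightarrow> real"
  assumes obs: "\<And>i. bounded_linear (obs i)" and \<Gamma>: "symmetric_posdef \<Gamma>"
  shows "(potential obs y \<Gamma> has_derivative potential_deriv obs y \<Gamma> u) (at u)"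
proof -
  have O: "(observe obs has_derivative observe obs) (at u)"
    unfolding observe_def
    by (subst has_derivative_componentwise_within)
      (auto simp: Basis_vec_def inner_axis intro: bounded_linear_imp_has_derivative obs)
  have r: "((\<lambda>u. y - observe obs u) has_derivative (\<lambda>w. - observe obs w)) (at u)"
    using has_derivative_diff[OF has_derivative_const O, of y] by simp
  note Gr = bounded_linear.has_derivative[OF matrix_vector_mul_bounded_linear r, of "matrix_inv \<Gamma>"]
  have sym: "(matrix_inv \<Gamma> *v a) \<bullet> b = a \<bullet> (matrix_inv \<Gamma> *v b)" for a b
    by (metis \<Gamma> dot_lmul_matrix transpose_matrix_inv_symmetric_posdef transpose_matrix_vector)
  have "((\<lambda>u. (1/2) * ((y - observe obs u) \<bullet> (matrix_inv \<Gamma> *v (y - observe obs u)))) has_derivative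
     (\<lambda>w. (1/2) * ((y - observe obs u) \<bullet> (matrix_inv \<Gamma> *v (- observe obs w))
        + (- observe obs w) \<bullet> (matrix_inv \<Gamma> *v (y - observe obs u))))) (at u)"
    by (intro has_derivative_mult_right has_derivative_inner r Gr)
  moreover have "(1/2) * ((y - observe obs u) \<bullet> (matrix_inv \<Gamma> *v (- observe obs w))
        + (- observe obs w) \<bullet> (matrix_inv \<Gamma> *v (y - observe obs u))) = potential_deriv obs y \<Gamma> u w" for w
  proof -
    have "(- observe obs w) \<bullet> (matrix_inv \<Gamma> *v (y - observe obs u))
        = (y - observe obs u) \<bullet> (matrix_inv \<Gamma> *v (- observe obs w))"
      by (metis inner_commute sym)
    moreover have "matrix_inv \<Gamma> *v (- observe obs w) = - (matrix_inv \<Gamma> *v observe obs w)"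
      by (simp add: linear_neg)
    ultimately show ?thesis by (simp add: potential_deriv_def)
  qed
  ultimately show ?thesis by (simp add: potential_def[abs_def])
qed

definition probability_density :: "(real^'d) set \<Rightarrow> (real^'d \<Rightarrow> real) \<Rightarrow> bool" where
  "probability_density \<Theta> p \<longleftrightarrow>
     p \<in> borel_measurable (lebesgue_on \<Theta>) \<and> (\<forall>\<theta>\<in>\<Theta>. 0 \<le> p \<theta>) \<and>
     (\<integral>\<^sup>+\<theta>. ennreal (p \<theta>) \<partial>lebesgue_on \<Theta>) = 1"

definition normalization ::
  "(real^'d) set \<Rightarrow> (real^'d \<Rightarrow> real) \<Rightarrow> (real^'d \<Rightarrow> real) \<Rightarrow> ennreal" where
  "normalization \<Theta> p0 \<eta> = (\<integral>\<^sup>+\<theta>. ennreal (exp (- \<eta> \<theta>) * p0 \<theta>) \<partial>lebesgue_on \<Theta>)"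

text \<open>Meaningful only for a finite (and nonzero) normalization constant.\<close>

definition posterior_density ::
  "(real^'d) set \<Rightarrow> (real^'d \<Rightarrow> real) \<Rightarrow> (real^'d \<Rightarrow> real) \<Rightarrow> real^'d \<Rightarrow> real" where
  "posterior_density \<Theta> p0 \<eta> \<theta> = 1 / enn2real (normalization \<Theta> p0 \<eta>) * exp (- \<eta> \<theta>) * p0 \<theta>"

definition posterior ::
  "(real^'d) set \<Rightarrow> (real^'d \<Rightarrow> real) \<Rightarrow> (real^'d \<Rightarrow> real) \<Rightarrow> (real^'d) measure" where
  "posterior \<Theta> p0 \<eta> = density (lebesgue_on \<Theta>) (\<lambda>\<theta>. ennreal (posterior_density \<Theta> p0 \<eta> \<theta>))"

text \<open>
  The Kullback-Leibler divergence \<open>\<integral> p\<^sub>1 log (p\<^sub>1/p\<^sub>2)\<close> of probability densities on \<open>\<Theta>\<close> may be \<open>+\<infinity>\<close>,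
  whereas \<^const>\<open>KL_divergence\<close> is real-valued and \<open>0\<close> in that case.  We therefore take the integral
  as positive part minus negative part; the latter is always finite, since
  \<open>p\<^sub>1 log (p\<^sub>1/p\<^sub>2) \<ge> p\<^sub>1 - p\<^sub>2\<close>.  With \<open>p\<^sub>1 = 0\<close> the integrand is \<open>0\<close>, as usual.
\<close>

definition D_KL :: "(real^'d) set \<Rightarrow> (real^'d \<Rightarrow> real) \<Rightarrow> (real^'d \<Rightarrow> real) \<Rightarrow> ereal" where
  "D_KL \<Theta> p1 p2 =
     enn2ereal (\<integral>\<^sup>+\<theta>. ennreal (p1 \<theta> * ln (p1 \<theta> / p2 \<theta>)) \<partial>lebesgue_on \<Theta>)
     - enn2ereal (\<integral>\<^sup>+\<theta>. ennreal (- (p1 \<theta> * ln (p1 \<theta> / p2 \<theta>))) \<partial>lebesgue_on \<Theta>)"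

lemma D_KL_eq_KL_divergence:
  fixes \<Theta> :: "(real^'d) set"
  assumes \<Theta>: "\<Theta> \<in> sets lebesgue"
    and p1: "probability_density \<Theta> p1" and p2: "probability_density \<Theta> p2"
    and ac: "\<And>\<theta>. \<theta> \<in> \<Theta> \<Longrightarrow> p2 \<theta> = 0 \<Longrightarrow> p1 \<theta> = 0"
    and int: "integrable (lebesgue_on \<Theta>) (\<lambda>\<theta>. p1 \<theta> * ln (p1 \<theta> / p2 \<theta>))"
  shows "D_KL \<Theta> p1 p2 =
    ereal (KL_divergence (exp 1) (density (lebesgue_on \<Theta>) (\<lambda>\<theta>. ennreal (p2 \<theta>)))
                                 (density (lebesgue_on \<Theta>) (\<lambda>\<theta>. ennreal (p1 \<theta>))))"
proof -
  obtain C :: "(real^'d) set set" where C: "countable C" "C \<subseteq> sets lborel" "\<Union>C = space lborel"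
      "\<forall>a\<in>C. emeasure lborel a \<noteq> \<infinity>"
    using lborel.sigma_finite_countable by blast
  have "sigma_finite_measure (lebesgue :: (real^'d) measure)"
  proof (rule sigma_finite_measure.intro, intro exI[of _ C] conjI ballI)
    show "countable C" "C \<subseteq> sets lebesgue" "\<Union>C = space (lebesgue :: (real^'d) measure)"
      using C by auto
    show "emeasure lebesgue a \<noteq> \<infinity>" if "a \<in> C" for a
      using C that by auto
  qed
  then interpret sigma_finite_measure "lebesgue_on \<Theta>"
    using \<Theta> by (rule sigma_finite_measure_restrict_space)
  have ln: "log (exp 1) x = ln x" for x :: real by (simp add: log_def)
  have "KL_divergence (exp 1) (density (lebesgue_on \<Theta>) (\<lambda>\<theta>. ennreal (p2 \<theta>)))
             (density (lebesgue_on \<Theta>) (\<lambda>\<theta>. ennreal (p1 \<theta>)))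
        = (\<integral>\<theta>. p1 \<theta> * log (exp 1) (p1 \<theta> / p2 \<theta>) \<partial>lebesgue_on \<Theta>)"
    using p1 p2 ac by (intro KL_density_density) (auto simp: probability_density_def)
  also have "\<dots> = (\<integral>\<theta>. p1 \<theta> * ln (p1 \<theta> / p2 \<theta>) \<partial>lebesgue_on \<Theta>)"
    by (simp only: ln)
  also have "\<dots> = enn2real (\<integral>\<^sup>+\<theta>. ennreal (p1 \<theta> * ln (p1 \<theta> / p2 \<theta>)) \<partial>lebesgue_on \<Theta>)
      - enn2real (\<integral>\<^sup>+\<theta>. ennreal (- (p1 \<theta> * ln (p1 \<theta> / p2 \<theta>))) \<partial>lebesgue_on \<Theta>)"
    by (rule real_lebesgue_integral_def[OF int])
  finally have KL: "KL_divergence (exp 1) (density (lebesgue_on \<Theta>) (\<lambda>\<theta>. ennreal (p2 \<theta>)))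
             (density (lebesgue_on \<Theta>) (\<lambda>\<theta>. ennreal (p1 \<theta>))) = \<dots>" .
  have fin: "(\<integral>\<^sup>+\<theta>. ennreal (p1 \<theta> * ln (p1 \<theta> / p2 \<theta>)) \<partial>lebesgue_on \<Theta>) \<noteq> \<infinity>"
    "(\<integral>\<^sup>+\<theta>. ennreal (- (p1 \<theta> * ln (p1 \<theta> / p2 \<theta>))) \<partial>lebesgue_on \<Theta>) \<noteq> \<infinity>"
    using int by (auto simp: real_integrable_def)
  have "enn2ereal x = ereal (enn2real x)" if "x \<noteq> \<infinity>" for x
    using that by (cases x) auto
  then show ?thesis
    unfolding D_KL_def KL using fin by simp
qed

text \<open>Expectation of a nonnegative random variable, possibly infinite.\<close>

definition expect :: "'a measure \<Rightarrow> ('a \<Rightarrow> real) \<Rightarrow> ereal" where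
  "expect \<mu> X = enn2ereal (\<integral>\<^sup>+\<theta>. ennreal (X \<theta>) \<partial>\<mu>)"

end

theory Submission imports Defs begin

text \<open>
  Write \<open>e = \<eta>\<^sub>1 - \<eta>\<^sub>2\<close> for two potentials.  The log-ratio of the posterior densities is
  \<open>- e + ln (Z\<^sub>2 / Z\<^sub>1)\<close>, and \<open>Z\<^sub>2 / Z\<^sub>1\<close> is the posterior mean of \<open>exp e\<close>, so that
  \<open>ln (Z\<^sub>2 / Z\<^sub>1) \<le> Z\<^sub>2 / Z\<^sub>1 - 1\<close> is at most the posterior mean of \<open>\<bar>exp e - 1\<bar>\<close>.
  This requires measurable potentials.  They are even continuous in the parameter, because the
  solution of a coercive Galerkin problem on a fixed finite-dimensional space depends
  continuously on the form and the functional.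
\<close>

section \<open>Continuity of Galerkin solutions\<close>

text \<open>Gram-Schmidt yields an orthogonal spanning set that may contain 0, so 0 is discarded
  before the vectors are normalised. The ambient space may be infinite-dimensional; arguments on a
  finite-dimensional subspace run through such a basis of it.\<close>

lemma orthonormal_basis_span:
  fixes B :: "'v::real_inner set"
  assumes "finite B"
  obtains E where "finite E" "span E = span B" "pairwise orthogonal E" "\<And>e. e \<in> E \<Longrightarrow> norm e = 1"
proof -
  obtain C where C: "finite C" "span C = span B" "pairwise orthogonal C"
    using basis_orthogonal[OF assms] by blast
  let ?f = "\<lambda>x::'v. x /\<^sub>R norm x"
  let ?E = "?f ` (C - {0})"
  have span_E: "span (C - {0}) = span ?E"
  proof (rule span_eq[THEN iffD2], intro conjI subsetI)
    fix x assume x: "x \<in> C - {0}"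
    then have "norm x *\<^sub>R ?f x \<in> span ?E"
      by (intro span_scale span_base) blast
    with x show "x \<in> span ?E" by simp
  next
    fix x assume "x \<in> ?E"
    then obtain c where "c \<in> C - {0}" "x = ?f c" by blast
    then show "x \<in> span (C - {0})"
      by (simp only: span_scale span_base)
  qed
  show thesis
  proof (rule that)
    show "finite ?E" using C(1) by simp
    show "span ?E = span B" using span_E[symmetric] C(2) by (simp only: span_delete_0)
    show "pairwise orthogonal ?E"
      using C(3) by (auto simp: pairwise_def orthogonal_def)
    show "norm e = 1" if "e \<in> ?E" for e
      using that by (auto simp: field_simps split: if_splits)
  qed
qed

text \<open>An independent subset of the span of a finite set is finite. This supplies finite
  spanning sets for \<open>Vr\<close> and \<open>Wr\<close>, which are given only as subspaces of
  \<open>Vh\<close>.\<close>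

lemma finite_spanning_subspace:
  assumes "finite B" "subspace S" "S \<subseteq> span B"
  obtains C where "finite C" "span C = S"
proof -
  obtain C where C: "C \<subseteq> S" "independent C" "S \<subseteq> span C"
    by (rule maximal_independent_subset)
  then have "finite C"
    using independent_span_bound[OF assms(1), of C] assms(3) by blast
  moreover have "span C = S"
    using C assms(2) by (simp add: span_minimal subset_antisym)
  ultimately show thesis by (rule that)
qed

lemma linear_expand_orthonormal:
  fixes L :: "'v::real_inner \<Rightarrow> real"
  assumes "finite E" "pairwise orthogonal E" "\<And>e. e \<in> E \<Longrightarrow> norm e = 1"
    and "linear L" "x \<in> span E"
  shows "L x = (\<Sum>e\<in>E. (x \<bullet> e) * L e)"
proof -
  have "L x = L (\<Sum>e\<in>E. (x \<bullet> e) *\<^sub>R e)"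
    using orthonormal_basis_expand[of E x] assms by simp
  also have "\<dots> = (\<Sum>e\<in>E. (x \<bullet> e) * L e)"
    using \<open>linear L\<close> by (simp add: linear_sum linear_cmul)
  finally show ?thesis .
qed

text \<open>The bound involves \<open>L\<close> only through its finitely many values on
  \<open>E\<close>. It therefore turns convergence of functionals on each basis vector into uniform
  convergence on the unit ball of the span.\<close>

lemma linear_bound_orthonormal:
  fixes L :: "'v::real_inner \<Rightarrow> real"
  assumes "finite E" "pairwise orthogonal E" "\<And>e. e \<in> E \<Longrightarrow> norm e = 1"
    and "linear L" "x \<in> span E"
  shows "\<bar>L x\<bar> \<le> norm x * (\<Sum>e\<in>E. \<bar>L e\<bar>)"
proof -
  have "\<bar>L x\<bar> \<le> (\<Sum>e\<in>E. \<bar>(x \<bullet> e) * L e\<bar>)"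
    by (subst linear_expand_orthonormal[OF assms]) (auto intro: sum_abs)
  also have "\<dots> \<le> (\<Sum>e\<in>E. norm x * \<bar>L e\<bar>)"
  proof (rule sum_mono)
    fix e assume "e \<in> E"
    with Cauchy_Schwarz_ineq2[of x e] assms(3)[of e]
    show "\<bar>(x \<bullet> e) * L e\<bar> \<le> norm x * \<bar>L e\<bar>"
      by (auto simp: abs_mult intro!: mult_right_mono)
  qed
  finally show ?thesis by (simp add: sum_distrib_left)
qed

text \<open>The linear bound is applied to each argument in turn, and each application contributes
  one factor \<open>norm x\<close>.\<close>

lemma bilinear_bound_orthonormal:
  fixes b :: "'v::real_inner \<Rightarrow> 'v \<Rightarrow> real"
  assumes E: "finite E" "pairwise orthogonal E" "\<And>e. e \<in> E \<Longrightarrow> norm e = 1"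
    and b: "bilinear b" and x: "x \<in> span E"
  shows "\<bar>b x x\<bar> \<le> (norm x)\<^sup>2 * (\<Sum>e\<in>E. \<Sum>e'\<in>E. \<bar>b e e'\<bar>)"
proof -
  have "\<bar>b x x\<bar> \<le> norm x * (\<Sum>e\<in>E. \<bar>b e x\<bar>)"
    using b by (intro linear_bound_orthonormal[OF E _ x]) (auto simp: bilinear_def)
  also have "\<dots> \<le> norm x * (\<Sum>e\<in>E. norm x * (\<Sum>e'\<in>E. \<bar>b e e'\<bar>))"
    using b by (intro mult_left_mono sum_mono linear_bound_orthonormal[OF E _ x])
      (auto simp: bilinear_def)
  finally show ?thesis
    by (simp add: power2_eq_square sum_distrib_left mult.assoc)
qed

text \<open>Passes from a fixed argument \<open>v\<close> to one moving with \<open>t\<close>: in a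
  fixed orthonormal basis, \<open>L t (u t)\<close> is a finite sum of products of continuous
  functions of \<open>t\<close>.\<close>

lemma continuous_on_linear_family:
  fixes L :: "'a::topological_space \<Rightarrow> 'v::real_inner \<Rightarrow> real"
  assumes "finite B" "\<And>t. t \<in> T \<Longrightarrow> linear (L t)"
    and L: "\<And>v. v \<in> span B \<Longrightarrow> continuous_on T (\<lambda>t. L t v)"
    and u: "continuous_on T u" "\<And>t. t \<in> T \<Longrightarrow> u t \<in> span B"
  shows "continuous_on T (\<lambda>t. L t (u t))"
proof -
  obtain E where E: "finite E" "span E = span B" "pairwise orthogonal E" "\<And>e. e \<in> E \<Longrightarrow> norm e = 1"
    using orthonormal_basis_span[OF assms(1)] by blast
  have "continuous_on T (\<lambda>t. \<Sum>e\<in>E. (u t \<bullet> e) * L t e)"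
    using E(2) by (intro continuous_intros u L) (metis span_base)
  moreover have "L t (u t) = (\<Sum>e\<in>E. (u t \<bullet> e) * L t e)" if "t \<in> T" for t
    using that E assms by (intro linear_expand_orthonormal) auto
  ultimately show ?thesis by (simp cong: continuous_on_cong)
qed

text \<open>A perturbation estimate: near \<open>s\<close>, the norm of \<open>u t - u s\<close> is
  controlled by the residual that \<open>u s\<close> leaves in the problem at \<open>t\<close>, and
  this residual vanishes as \<open>t\<close> tends to \<open>s\<close>.\<close>

lemma galerkin_solution_continuous_on:
  fixes a :: "'a::topological_space \<Rightarrow> 'v::real_inner \<Rightarrow> 'v \<Rightarrow> real"
  assumes B: "finite B"
    and bil: "\<And>t. t \<in> T \<Longrightarrow> bilinear (a t)" and lin: "\<And>t. t \<in> T \<Longrightarrow> linear (L t)"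
    and coercive: "\<And>t. t \<in> T \<Longrightarrow> \<exists>\<alpha>>0. \<forall>w\<in>span B. \<alpha> * (norm w)\<^sup>2 \<le> a t w w"
    and a_cont: "\<And>w v. w \<in> span B \<Longrightarrow> v \<in> span B \<Longrightarrow> continuous_on T (\<lambda>t. a t w v)"
    and L_cont: "\<And>v. v \<in> span B \<Longrightarrow> continuous_on T (\<lambda>t. L t v)"
    and u: "\<And>t. t \<in> T \<Longrightarrow> u t \<in> span B"
    and sol: "\<And>t v. t \<in> T \<Longrightarrow> v \<in> span B \<Longrightarrow> a t (u t) v = L t v"
  shows "continuous_on T u"
  unfolding continuous_on_def
proof
  fix s assume s: "s \<in> T"
  obtain E where E: "finite E" "span E = span B" "pairwise orthogonal E" "\<And>e. e \<in> E \<Longrightarrow> norm e = 1"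
    using orthonormal_basis_span[OF B] by blast
  obtain \<alpha> where \<alpha>: "\<alpha> > 0" "\<And>w. w \<in> span B \<Longrightarrow> \<alpha> * (norm w)\<^sup>2 \<le> a s w w"
    using coercive[OF s] by blast
  \<comment> \<open>Since \<open>L s\<close> and \<open>a s (u s)\<close> agree on the span,
    \<open>d1 t\<close> sums the absolute values on the basis of the residual
    \<open>L t v - a t (u s) v\<close>. \<open>d2 t\<close> is the entrywise distance between the
    matrices of the forms at \<open>t\<close> and at \<open>s\<close>.\<close>
  define d1 where "d1 t = (\<Sum>e\<in>E. \<bar>(L t e - L s e) - (a t (u s) e - a s (u s) e)\<bar>)" for t
  define d2 where "d2 t = (\<Sum>e\<in>E. \<Sum>e'\<in>E. \<bar>a t e e' - a s e e'\<bar>)" for t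
  have EB: "e \<in> span B" if "e \<in> E" for e
    using that E(2) span_base by blast
  have tendsto: "((\<lambda>t. a t w v) \<longlongrightarrow> a s w v) (at s within T)" "((\<lambda>t. L t v) \<longlongrightarrow> L s v) (at s within T)"
    if "w \<in> span B" "v \<in> span B" for w v
    using a_cont[OF that] L_cont[OF that(2)] s by (auto simp: continuous_on_def)
  have "(d1 \<longlongrightarrow> (\<Sum>e\<in>E. \<bar>(L s e - L s e) - (a s (u s) e - a s (u s) e)\<bar>)) (at s within T)"
    unfolding d1_def by (intro tendsto_intros tendsto[where v = "_" and w = "u s"] u s EB)
  then have d1: "(d1 \<longlongrightarrow> 0) (at s within T)" by simp
  have "(d2 \<longlongrightarrow> (\<Sum>e\<in>E. \<Sum>e'\<in>E. \<bar>a s e e' - a s e e'\<bar>)) (at s within T)"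
    unfolding d2_def by (intro tendsto_intros tendsto EB)
  then have d2: "(d2 \<longlongrightarrow> 0) (at s within T)" by simp
  \<comment> \<open>Test both problems with the difference \<open>u t - u s\<close>; coercivity at the fixed \<open>s\<close> suffices,
    so no lower bound on the coercivity constants near \<open>s\<close> is needed.\<close>
  have bound: "norm (u t - u s) \<le> d1 t / (\<alpha> / 2)" if t: "t \<in> T" and small: "d2 t < \<alpha> / 2" for t
  proof -
    let ?d = "u t - u s"
    have dB: "?d \<in> span B" using u[OF t] u[OF s] by (rule span_diff)
    interpret bt: Vector_Spaces.linear scaleR scaleR "\<lambda>w. a t w ?d"
      using bil[OF t] by (simp add: bilinear_def linear_def)
    define M where "M v = (L t v - L s v) - (a t (u s) v - a s (u s) v)" for v
    have M: "linear M"
      unfolding M_def using bil[OF t] bil[OF s] lin[OF t] lin[OF s]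
      by (intro linear_compose_sub) (auto simp: bilinear_def)
    have "a t ?d ?d = M ?d"
      using sol[OF t dB] sol[OF s dB] bt.diff[of "u t" "u s"] by (simp add: M_def)
    also have "\<bar>M ?d\<bar> \<le> norm ?d * d1 t"
      using linear_bound_orthonormal[OF E(1,3,4) M, of ?d] dB E(2) by (simp add: d1_def M_def)
    finally have upper: "a t ?d ?d \<le> norm ?d * d1 t" by linarith
    have "bilinear (\<lambda>w v. a t w v - a s w v)"
      using bil[OF t] bil[OF s] by (auto simp: bilinear_def intro!: linear_compose_sub)
    from bilinear_bound_orthonormal[OF E(1,3,4) this, of ?d]
    have "\<bar>a t ?d ?d - a s ?d ?d\<bar> \<le> (norm ?d)\<^sup>2 * d2 t"
      using dB E(2) by (simp add: d2_def)
    \<comment> \<open>Half of the coercivity constant at \<open>s\<close> pays for replacing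
      \<open>a s\<close> by \<open>a t\<close>; the other half remains to bound
      \<open>?d\<close>.\<close>
    also have "\<dots> \<le> (norm ?d)\<^sup>2 * (\<alpha> / 2)"
      using small by (intro mult_left_mono) auto
    finally have "a s ?d ?d - a t ?d ?d \<le> (norm ?d)\<^sup>2 * (\<alpha> / 2)"
      by linarith
    with \<alpha>(2)[OF dB] upper have "\<alpha> / 2 * (norm ?d)\<^sup>2 \<le> norm ?d * d1 t"
      by (simp add: field_simps)
    \<comment> \<open>This settles the case \<open>?d = 0\<close>, where the factor
      \<open>norm ?d\<close> cannot be cancelled.\<close>
    moreover have "0 \<le> d1 t" unfolding d1_def by (intro sum_nonneg) auto
    ultimately show ?thesis
      using \<alpha>(1) by (cases "norm ?d = 0") (auto simp: power2_eq_square field_simps)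
  qed
  have "eventually (\<lambda>t. d2 t < \<alpha> / 2) (at s within T)"
    using order_tendstoD(2)[OF d2, of "\<alpha> / 2"] \<alpha>(1) by simp
  moreover have "eventually (\<lambda>t. t \<in> T) (at s within T)"
    by (simp add: eventually_at_filter)
  ultimately have "eventually (\<lambda>t. norm (u t - u s) \<le> d1 t / (\<alpha> / 2)) (at s within T)"
    by eventually_elim (rule bound)
  moreover have "((\<lambda>t. d1 t / (\<alpha> / 2)) \<longlongrightarrow> 0) (at s within T)"
    using tendsto_divide[OF d1 tendsto_const[of "\<alpha> / 2"]] \<alpha>(1) by simp
  ultimately have "((\<lambda>t. u t - u s) \<longlongrightarrow> 0) (at s within T)"
    by (rule Lim_null_comparison)
  then show "(u \<longlongrightarrow> u s) (at s within T)" by (simp add: LIM_zero_iff)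
qed

lemma C1_with_partials_continuous_on:
  "C1_with_partials \<Theta> g g' \<Longrightarrow> continuous_on \<Theta> g"
  unfolding C1_with_partials_def by (intro has_derivative_continuous_on) blast

section \<open>The potential\<close>

lemma continuous_on_observe:
  assumes "\<And>i. bounded_linear (obs i)" "continuous_on T u"
  shows "continuous_on T (\<lambda>t. observe obs (u t))"
  unfolding observe_def
  by (intro continuous_on_vec_lambda bounded_linear.continuous_on[OF assms(1)] assms(2))

lemma continuous_on_potential:
  assumes "\<And>i. bounded_linear (obs i)" "continuous_on T u"
  shows "continuous_on T (\<lambda>t. potential obs y \<Gamma> (u t))"
  unfolding potential_def
  by (intro continuous_intros continuous_on_observe[OF assms]
      bounded_linear.continuous_on[OF matrix_vector_mul_bounded_linear])

lemma continuous_on_potential_deriv: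
  assumes "\<And>i. bounded_linear (obs i)" "continuous_on T u"
  shows "continuous_on T (\<lambda>t. potential_deriv obs y \<Gamma> (u t) w)"
  unfolding potential_deriv_def
  by (intro continuous_intros continuous_on_observe[OF assms])

lemma linear_potential_deriv:
  assumes "\<And>i. linear (obs i)"
  shows "linear (potential_deriv obs y \<Gamma> u)"
proof -
  have "observe obs (v + w) = observe obs v + observe obs w"
    and "observe obs (c *\<^sub>R v) = c *\<^sub>R observe obs v" for v w c
    using assms by (simp_all add: observe_def vec_eq_iff linear_add linear_cmul)
  then show ?thesis
    by (intro linearI) (simp_all add: potential_deriv_def matrix_vector_right_distrib
        inner_add_right linear_cmul)
qed

text \<open>With z the inverse of \<open>\<Gamma>\<close> applied to the misfit, the quadratic form
  of the inverse at the misfit equals that of \<open>\<Gamma>\<close> at z, so positivity of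
  \<open>\<Gamma>\<close> applies directly.\<close>

lemma potential_nonneg:
  assumes "symmetric_posdef \<Gamma>"
  shows "0 \<le> potential obs y \<Gamma> u"
proof -
  define z where "z = matrix_inv \<Gamma> *v (y - observe obs u)"
  have "\<Gamma> ** matrix_inv \<Gamma> = mat 1"
    using symmetric_posdef_invertible[OF assms] unfolding invertible_def matrix_inv_def
    by (rule someI2_ex) simp
  then have "\<Gamma> *v z = y - observe obs u"
    by (simp add: z_def matrix_vector_mul_assoc)
  moreover have "0 \<le> z \<bullet> (\<Gamma> *v z)"
    using assms by (cases "z = 0") (auto simp: symmetric_posdef_def less_imp_le)
  ultimately show ?thesis
    by (simp add: potential_def z_def inner_commute)
qed

section \<open>Comparison of posteriors\<close>

text \<open>For a nonnegative potential the likelihood is at most 1, so the constant is at most the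
  prior mass. This serves the potentials at \<open>uh\<close> and \<open>ur\<close>; the correction
  term in \<open>\<eta>\<Delta>\<close> has no definite sign, and finiteness is a hypothesis
  there.\<close>

lemma normalization_le_1:
  assumes p0: "probability_density \<Theta> p0" and nonneg: "\<And>\<theta>. \<theta> \<in> \<Theta> \<Longrightarrow> 0 \<le> \<eta> \<theta>"
  shows "normalization \<Theta> p0 \<eta> \<le> 1"
proof -
  have "normalization \<Theta> p0 \<eta> \<le> (\<integral>\<^sup>+\<theta>. ennreal (p0 \<theta>) \<partial>lebesgue_on \<Theta>)"
    unfolding normalization_def using assms
    by (intro nn_integral_mono ennreal_leI) (auto simp: probability_density_def mult_left_le_one_le)
  with p0 show ?thesis by (simp add: probability_density_def)
qed

text \<open>Because exp is positive, a zero constant would force the prior density to vanish almost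
  everywhere, against its mass 1. Positivity is what permits division by the constants
  below.\<close>

lemma normalization_pos:
  assumes p0: "probability_density \<Theta> p0" and \<eta>: "\<eta> \<in> borel_measurable (lebesgue_on \<Theta>)"
  shows "normalization \<Theta> p0 \<eta> > 0"
proof (rule ccontr)
  note [measurable] = \<eta>
  have [measurable]: "p0 \<in> borel_measurable (lebesgue_on \<Theta>)"
    using p0 by (simp add: probability_density_def)
  assume "\<not> normalization \<Theta> p0 \<eta> > 0"
  then have "AE \<theta> in lebesgue_on \<Theta>. ennreal (exp (- \<eta> \<theta>) * p0 \<theta>) = 0"
    by (simp add: normalization_def nn_integral_0_iff_AE)
  then have "AE \<theta> in lebesgue_on \<Theta>. ennreal (p0 \<theta>) = 0"
    by eventually_elim (simp add: ennreal_eq_0_iff mult_le_0_iff)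
  then have "(\<integral>\<^sup>+\<theta>. ennreal (p0 \<theta>) \<partial>lebesgue_on \<Theta>) = 0"
    by (simp add: nn_integral_0_iff_AE)
  with p0 show False by (simp add: probability_density_def)
qed

text \<open>One estimate serves both claims, with \<open>f\<close> the full-order potential and
  \<open>g\<close> either approximation. The bounds are carried out in \<open>ennreal\<close>, since
  either expectation may be infinite.\<close>

lemma D_KL_posterior_le:
  fixes \<Theta> :: "(real^'d) set"
  assumes p0: "probability_density \<Theta> p0"
    and f: "f \<in> borel_measurable (lebesgue_on \<Theta>)" and g: "g \<in> borel_measurable (lebesgue_on \<Theta>)"
    and Zf: "normalization \<Theta> p0 f < \<infinity>" and Zg: "normalization \<Theta> p0 g < \<infinity>"
  shows "D_KL \<Theta> (posterior_density \<Theta> p0 f) (posterior_density \<Theta> p0 g)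
    \<le> expect (posterior \<Theta> p0 f) (\<lambda>\<theta>. \<bar>f \<theta> - g \<theta>\<bar>)
      + expect (posterior \<Theta> p0 f) (\<lambda>\<theta>. \<bar>exp (f \<theta> - g \<theta>) - 1\<bar>)"
proof -
  let ?M = "lebesgue_on \<Theta>"
  note [measurable] = f g
  have [measurable]: "p0 \<in> borel_measurable ?M" and p0_nonneg: "\<And>\<theta>. \<theta> \<in> \<Theta> \<Longrightarrow> 0 \<le> p0 \<theta>"
    using p0 by (auto simp: probability_density_def)
  define p q where "p = posterior_density \<Theta> p0 f" and "q = posterior_density \<Theta> p0 g"
  define a b where "a = enn2real (normalization \<Theta> p0 f)" and "b = enn2real (normalization \<Theta> p0 g)"
  have a: "normalization \<Theta> p0 f = ennreal a" "a > 0"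
    using Zf normalization_pos[OF p0 f] by (auto simp: a_def enn2real_positive_iff)
  have b: "normalization \<Theta> p0 g = ennreal b" "b > 0"
    using Zg normalization_pos[OF p0 g] by (auto simp: b_def enn2real_positive_iff)
  have p_eq: "p = (\<lambda>\<theta>. 1 / a * exp (- f \<theta>) * p0 \<theta>)" and q_eq: "q = (\<lambda>\<theta>. 1 / b * exp (- g \<theta>) * p0 \<theta>)"
    by (auto simp: p_def q_def posterior_density_def a_def b_def)
  have [measurable]: "p \<in> borel_measurable ?M" unfolding p_eq by measurable
  have p_nonneg: "0 \<le> p \<theta>" if "\<theta> \<in> \<Theta>" for \<theta>
    using that a p0_nonneg by (simp add: p_eq)
  have "(\<integral>\<^sup>+\<theta>. ennreal (p \<theta>) \<partial>?M) = (\<integral>\<^sup>+\<theta>. ennreal (1 / a) * ennreal (exp (- f \<theta>) * p0 \<theta>) \<partial>?M)"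
    using a p0_nonneg by (intro nn_integral_cong) (simp add: p_eq mult.assoc flip: ennreal_mult)
  also have "\<dots> = ennreal (1 / a) * ennreal a"
    by (simp add: nn_integral_cmult normalization_def[symmetric] a)
  finally have p_prob: "(\<integral>\<^sup>+\<theta>. ennreal (p \<theta>) \<partial>?M) = 1"
    using a by (simp flip: ennreal_mult)
  define mean where "mean X = (\<integral>\<^sup>+\<theta>. ennreal (p \<theta>) * ennreal (X \<theta>) \<partial>?M)" for X
  have expect: "expect (posterior \<Theta> p0 f) X = enn2ereal (mean X)"
    if [measurable]: "X \<in> borel_measurable ?M" for X
    unfolding expect_def posterior_def mean_def p_def[symmetric] by (simp add: nn_integral_density)
  let ?E = "\<lambda>\<theta>. \<bar>exp (f \<theta> - g \<theta>) - 1\<bar>"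
  \<comment> \<open>The unnormalised density for \<open>g\<close> is \<open>a * p\<close> times exp
    (f - g), and exp (f - g) is at most \<open>1 + ?E\<close>. Integrating gives the bound on
    \<open>b / a\<close> in multiplied-out form, which avoids division in
    \<open>ennreal\<close>.\<close>
  have "ennreal b \<le> (\<integral>\<^sup>+\<theta>. ennreal a * (ennreal (p \<theta>) + ennreal (p \<theta>) * ennreal (?E \<theta>)) \<partial>?M)"
    unfolding b(1)[symmetric] normalization_def
  proof (intro nn_integral_mono)
    fix \<theta> assume "\<theta> \<in> space ?M"
    then have \<theta>: "\<theta> \<in> \<Theta>" by simp
    have "exp (- g \<theta>) * p0 \<theta> = exp (- f \<theta>) * p0 \<theta> * exp (f \<theta> - g \<theta>)"
      by (simp add: mult.commute mult.left_commute flip: exp_add)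
    also have "\<dots> = a * (p \<theta> * exp (f \<theta> - g \<theta>))"
      using a by (simp add: p_eq)
    also have "\<dots> \<le> a * (p \<theta> * (1 + ?E \<theta>))"
      using a p_nonneg[OF \<theta>] by (intro mult_left_mono) auto
    finally have "ennreal (exp (- g \<theta>) * p0 \<theta>) \<le> ennreal (a * (p \<theta> + p \<theta> * ?E \<theta>))"
      by (intro ennreal_leI) (simp add: distrib_left)
    then show "ennreal (exp (- g \<theta>) * p0 \<theta>) \<le> ennreal a * (ennreal (p \<theta>) + ennreal (p \<theta>) * ennreal (?E \<theta>))"
      using a p_nonneg[OF \<theta>] by (simp add: ennreal_mult ennreal_plus)
  qed
  also have "\<dots> = ennreal a * (1 + mean ?E)"
    by (simp add: nn_integral_cmult nn_integral_add p_prob mean_def)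
  finally have ratio: "ennreal b \<le> ennreal a * (1 + mean ?E)" .
  \<comment> \<open>\<open>ln (b / a)\<close> may be negative, while \<open>ennreal\<close>
    truncates at 0; the maximum keeps the sum below splitting into nonnegative terms. If the mean is
    infinite, the bound on \<open>c\<close> is trivial.\<close>
  define c where "c = max 0 (ln (b / a))"
  have c: "ennreal c \<le> mean ?E"
  proof (cases "mean ?E")
    case (real r)
    then have "ennreal b \<le> ennreal (a * (1 + r))"
      using ratio a(2) by (simp add: ennreal_mult del: ennreal_1 flip: ennreal_plus ennreal_1)
    then have "b \<le> a * (1 + r)"
      using a(2) real(1) by (subst (asm) ennreal_le_iff) auto
    then have "b / a \<le> 1 + r"
      using a(2) by (simp add: field_simps)
    moreover have "ln (b / a) \<le> b / a - 1"
      using a b by (intro ln_le_minus_one) auto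
    ultimately show ?thesis using real by (simp add: c_def ennreal_leI)
  qed simp
  have "(\<integral>\<^sup>+\<theta>. ennreal (p \<theta> * ln (p \<theta> / q \<theta>)) \<partial>?M)
    \<le> (\<integral>\<^sup>+\<theta>. ennreal (p \<theta>) * ennreal \<bar>f \<theta> - g \<theta>\<bar> + ennreal c * ennreal (p \<theta>) \<partial>?M)"
  proof (intro nn_integral_mono)
    fix \<theta> assume "\<theta> \<in> space ?M"
    then have \<theta>: "\<theta> \<in> \<Theta>" by simp
    \<comment> \<open>Where the prior density is nonzero it cancels from the quotient; where it
      vanishes, so does \<open>p\<close>, and both sides are 0.\<close>
    have "p \<theta> * ln (p \<theta> / q \<theta>) \<le> p \<theta> * (\<bar>f \<theta> - g \<theta>\<bar> + c)"
    proof (cases "p0 \<theta> = 0")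
      case False
      then have "p \<theta> / q \<theta> = exp (g \<theta> - f \<theta>) * (b / a)"
        using a b by (simp add: p_eq q_eq field_simps flip: exp_add)
      then have "ln (p \<theta> / q \<theta>) = g \<theta> - f \<theta> + ln (b / a)"
        using a b by (simp only: ln_mult_pos[OF exp_gt_zero divide_pos_pos[OF b(2) a(2)]] ln_exp)
      also have "\<dots> \<le> \<bar>f \<theta> - g \<theta>\<bar> + c" by (auto simp: c_def)
      finally show ?thesis using p_nonneg[OF \<theta>] by (rule mult_left_mono)
    qed (simp add: p_eq)
    then have "ennreal (p \<theta> * ln (p \<theta> / q \<theta>)) \<le> ennreal (p \<theta> * \<bar>f \<theta> - g \<theta>\<bar> + c * p \<theta>)"
      by (intro ennreal_leI) (simp add: algebra_simps)
    then show "ennreal (p \<theta> * ln (p \<theta> / q \<theta>)) \<le> ennreal (p \<theta>) * ennreal \<bar>f \<theta> - g \<theta>\<bar> + ennreal c * ennreal (p \<theta>)"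
      using p_nonneg[OF \<theta>] by (simp add: ennreal_mult ennreal_plus c_def)
  qed
  also have "\<dots> = mean (\<lambda>\<theta>. \<bar>f \<theta> - g \<theta>\<bar>) + ennreal c"
    by (simp add: nn_integral_cmult nn_integral_add p_prob mean_def)
  also have "\<dots> \<le> mean (\<lambda>\<theta>. \<bar>f \<theta> - g \<theta>\<bar>) + mean ?E"
    using c by (rule add_left_mono)
  finally have "enn2ereal (\<integral>\<^sup>+\<theta>. ennreal (p \<theta> * ln (p \<theta> / q \<theta>)) \<partial>?M)
      \<le> enn2ereal (mean (\<lambda>\<theta>. \<bar>f \<theta> - g \<theta>\<bar>)) + enn2ereal (mean ?E)"
    by (simp add: less_eq_ennreal.rep_eq plus_ennreal.rep_eq)
  \<comment> \<open>The negative part is dropped; this is sound even for \<open>\<infinity> - \<infinity>\<close>, which is \<open>\<infinity>\<close> in \<open>ereal\<close>.\<close>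
  moreover have "x - enn2ereal z \<le> x" for x z
    using ereal_diff_le_self[of "enn2ereal z" x] by simp
  ultimately show ?thesis
    unfolding D_KL_def p_def[symmetric] q_def[symmetric]
    by (subst (1 2) expect) (auto intro: order_trans)
qed

section \<open>Continuity of the three potentials, and the conclusion\<close>

theorem theorem5p6:
  fixes \<Theta> :: "(real^'d) set"
    and p0 :: "real^'d \<Rightarrow> real"
    and A :: "'v::{real_inner, complete_space} \<Rightarrow> 'v \<Rightarrow> real^'d \<Rightarrow> real"
    and F :: "'v \<Rightarrow> real^'d \<Rightarrow> real"
    and obs :: "'s::finite \<Rightarrow> 'v \<Rightarrow> real"
    and y :: "real^'s"
    and \<Gamma> :: "real^'s^'s"
    and Vh Vr Wr :: "'v set"
    and uh ur \<psi>r :: "real^'d \<Rightarrow> 'v"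
    and \<eta>h \<eta>r \<eta>\<Delta> e\<eta> e\<Delta> :: "real^'d \<Rightarrow> real"
  assumes "\<Theta> \<in> sets lebesgue"
    and "probability_density \<Theta> p0"
    and "\<And>\<theta>. \<theta> \<in> \<Theta> \<Longrightarrow> bilinear (\<lambda>w v. A w v \<theta>)"
    and "\<And>\<theta>. \<theta> \<in> \<Theta> \<Longrightarrow> linear (\<lambda>v. F v \<theta>)"
    and "assumption_A1 \<Theta> A F"
    and "assumption_A2 \<Theta> A F"
    and "\<And>i. bounded_linear (obs i)"
    and "symmetric_posdef \<Gamma>"
    and "subspace Vh" and "\<exists>B. finite B \<and> span B = Vh"
    and "subspace Vr" and "Vr \<subseteq> Vh"
    and "subspace Wr" and "Wr \<subseteq> Vh"
    and "\<And>\<theta>. \<theta> \<in> \<Theta> \<Longrightarrow> uh \<theta> \<in> Vh \<and> (\<forall>v\<in>Vh. A (uh \<theta>) v \<theta> = F v \<theta>)"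
    and "\<And>\<theta>. \<theta> \<in> \<Theta> \<Longrightarrow> ur \<theta> \<in> Vr \<and> (\<forall>v\<in>Vr. A (ur \<theta>) v \<theta> = F v \<theta>)"
    and "\<And>\<theta>. \<theta> \<in> \<Theta> \<Longrightarrow>
           \<psi>r \<theta> \<in> Wr \<and> (\<forall>w\<in>Wr. A w (\<psi>r \<theta>) \<theta> = - potential_deriv obs y \<Gamma> (ur \<theta>) w)"
  defines "\<eta>h \<equiv> \<lambda>\<theta>. potential obs y \<Gamma> (uh \<theta>)"
    and "\<eta>r \<equiv> \<lambda>\<theta>. potential obs y \<Gamma> (ur \<theta>)"
    and "\<eta>\<Delta> \<equiv> \<lambda>\<theta>. potential obs y \<Gamma> (ur \<theta>) + A (ur \<theta>) (\<psi>r \<theta>) \<theta> - F (\<psi>r \<theta>) \<theta>"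
    and "e\<eta> \<equiv> \<lambda>\<theta>. \<eta>h \<theta> - \<eta>r \<theta>"
    and "e\<Delta> \<equiv> \<lambda>\<theta>. \<eta>h \<theta> - \<eta>\<Delta> \<theta>"
  assumes "normalization \<Theta> p0 \<eta>\<Delta> < \<infinity>"
  shows "D_KL \<Theta> (posterior_density \<Theta> p0 \<eta>h) (posterior_density \<Theta> p0 \<eta>r)
           \<le> expect (posterior \<Theta> p0 \<eta>h) (\<lambda>\<theta>. \<bar>e\<eta> \<theta>\<bar>)
             + expect (posterior \<Theta> p0 \<eta>h) (\<lambda>\<theta>. \<bar>exp (e\<eta> \<theta>) - 1\<bar>)
       \<and> D_KL \<Theta> (posterior_density \<Theta> p0 \<eta>h) (posterior_density \<Theta> p0 \<eta>\<Delta>)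
           \<le> expect (posterior \<Theta> p0 \<eta>h) (\<lambda>\<theta>. \<bar>e\<Delta> \<theta>\<bar>)
             + expect (posterior \<Theta> p0 \<eta>h) (\<lambda>\<theta>. \<bar>exp (e\<Delta> \<theta>) - 1\<bar>)"
proof -
  note bil = assms(3) and linF = assms(4) and A1 = assms(5) and A2 = assms(6)
  have obs: "\<And>i. bounded_linear (obs i)" by fact
  obtain B where B: "finite B" "span B = Vh" using assms(10) by blast
  obtain Br where Br: "finite Br" "span Br = Vr"
    using finite_spanning_subspace[of B Vr] B assms(11,12) by auto
  obtain Bw where Bw: "finite Bw" "span Bw = Wr"
    using finite_spanning_subspace[of B Wr] B assms(13,14) by auto
  have A_cont: "continuous_on \<Theta> (A w v)" and F_cont: "continuous_on \<Theta> (F v)" for w v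
    using A2 unfolding assumption_A2_def
    by (auto dest: C1_with_partials_continuous_on)
  have coercive: "\<exists>\<alpha>>0. \<forall>w\<in>S. \<alpha> * (norm w)\<^sup>2 \<le> A w w \<theta>" if "\<theta> \<in> \<Theta>" for \<theta> S
    using A1 that unfolding assumption_A1_def by blast
  have uh: "continuous_on \<Theta> uh"
    by (rule galerkin_solution_continuous_on
        [where a = "\<lambda>\<theta> w v. A w v \<theta>" and L = "\<lambda>\<theta> v. F v \<theta>", OF B(1)])
      (use B bil linF coercive A_cont F_cont assms(15) in auto)
  have ur: "continuous_on \<Theta> ur"
    by (rule galerkin_solution_continuous_on
        [where a = "\<lambda>\<theta> w v. A w v \<theta>" and L = "\<lambda>\<theta> v. F v \<theta>", OF Br(1)])
      (use Br bil linF coercive A_cont F_cont assms(16) in auto)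
  have lin_obs: "\<And>i. linear (obs i)" using obs by (rule bounded_linear.linear)
  \<comment> \<open>The unknown of the dual problem sits in the second slot of \<open>A\<close>, so
    the form is used with its arguments swapped; its diagonal, and with it coercivity, is unchanged.
    The right-hand side depends on \<theta> through \<open>ur\<close>, whose continuity is already
    available.\<close>
  have \<psi>r: "continuous_on \<Theta> \<psi>r"
    by (rule galerkin_solution_continuous_on
        [where a = "\<lambda>\<theta> w v. A v w \<theta>" and L = "\<lambda>\<theta> w. - potential_deriv obs y \<Gamma> (ur \<theta>) w", OF Bw(1)])
      (use Bw bil coercive A_cont assms(17) in \<open>auto simp: bilinear_def
        intro!: linear_compose_neg linear_potential_deriv lin_obs continuous_on_minus
          continuous_on_potential_deriv obs ur\<close>)
  \<comment> \<open>Both arguments of \<open>A\<close> move with \<theta>, so continuity is obtained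
    in two stages: first only the second argument follows \<open>\<psi>r\<close>, then the first
    follows \<open>ur\<close>.\<close>
  have A\<psi>: "continuous_on \<Theta> (\<lambda>\<theta>. A w (\<psi>r \<theta>) \<theta>)" for w
    by (rule continuous_on_linear_family[where L = "\<lambda>\<theta> v. A w v \<theta>", OF Bw(1)])
      (use Bw bil A_cont \<psi>r assms(17) in \<open>auto simp: bilinear_def\<close>)
  have Au\<psi>: "continuous_on \<Theta> (\<lambda>\<theta>. A (ur \<theta>) (\<psi>r \<theta>) \<theta>)"
    by (rule continuous_on_linear_family[where L = "\<lambda>\<theta> w. A w (\<psi>r \<theta>) \<theta>", OF Br(1)])
      (use Br bil ur A\<psi> assms(16) in \<open>auto simp: bilinear_def\<close>)
  have F\<psi>: "continuous_on \<Theta> (\<lambda>\<theta>. F (\<psi>r \<theta>) \<theta>)"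
    by (rule continuous_on_linear_family[where L = "\<lambda>\<theta> v. F v \<theta>", OF Bw(1)])
      (use Bw linF F_cont \<psi>r assms(17) in auto)
  have "continuous_on \<Theta> \<eta>h" "continuous_on \<Theta> \<eta>r" "continuous_on \<Theta> \<eta>\<Delta>"
    unfolding \<eta>h_def \<eta>r_def \<eta>\<Delta>_def
    by (intro continuous_on_add continuous_on_diff continuous_on_potential obs uh ur Au\<psi> F\<psi>)+
  then have meas: "\<eta>h \<in> borel_measurable (lebesgue_on \<Theta>)" "\<eta>r \<in> borel_measurable (lebesgue_on \<Theta>)"
      "\<eta>\<Delta> \<in> borel_measurable (lebesgue_on \<Theta>)"
    using assms(1) by (auto intro: continuous_imp_measurable_on_sets_lebesgue)
  have "normalization \<Theta> p0 \<eta>h \<le> 1" "normalization \<Theta> p0 \<eta>r \<le> 1"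
    unfolding \<eta>h_def \<eta>r_def using assms(2,8) by (auto intro!: normalization_le_1 potential_nonneg)
  then have "normalization \<Theta> p0 \<eta>h < \<infinity>" "normalization \<Theta> p0 \<eta>r < \<infinity>"
    by (auto intro: le_less_trans)
  then show ?thesis
    unfolding e\<eta>_def e\<Delta>_def using meas assms(2) \<open>normalization \<Theta> p0 \<eta>\<Delta> < \<infinity>\<close>
    by (intro conjI D_KL_posterior_le)
qed

end
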